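(* Let $J,R,Q\in\mathbb R^{n\times n}$, $B\in\mathbb R^{n\times m}$ with $J^\top=-J$, $R=R^\top\succeq0$, $Q=Q^\top\succ0$ define a minimal port-Hamiltonian system with $A=(J-R)Q$, $C=B^\top Q$ ($(A,B)$ controllable, $(A,C)$ observable). Let $\widehat{\mathcal P}_{\mathrm c}$ be the unique stabilizing solution of $A^\top\widehat{\mathcal P}_{\mathrm c}+\widehat{\mathcal P}_{\mathrm c}A-\widehat{\mathcal P}_{\mathrm c}BB^\top\widehat{\mathcal P}_{\mathrm c}+C^\top C=0$, with Cholesky decomposition $\widehat{\mathcal P}_{\mathrm c}=L_{\widehat{\mathcal P}_{\mathrm c}}^\top L_{\widehat{\mathcal P}_{\mathrm c}}$. For a positive definite solution $X=X^\top\succ0$ of the KYP linear matrix inequality $$\begin{bmatrix}-A^\top X-XA&C^\top-XB\\C-B^\top X&0\end{bmatrix}\succeq0$$ set $\theta_i(X)=\sqrt{\lambda_i\big(L_{\widehat{\mathcal P}_{\mathrm c}}(X+\widehat{\mathcal P}_{\mathrm c})^{-1}L_{\widehat{\mathcal P}_{\mathrm c}}^\top\big)}$, $i=1,\dots,n$. Let $X_{\max}=X_{\max}^\top\succ0$ be the maximal solution of the KYP linear matrix inequality. Then, for every positive definite solution $X$ (in particular for $X=Q$), $$\theta_i(X_{\max})\le\theta_i(X),\qquad i=1,\dots,n.$$ Consequently, for every $r$, the error bound $2\sum_{i=r+1}^n\theta_i(X)$ is minimized, among all port-Hamiltonian representations of the system corresponding to positive definite solutions $X$, by the choice $X=X_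{\max}$.
   Context: $\lambda_i(\cdot)$ denotes the $i$-th eigenvalue of a symmetric matrix, ordered monotonically (the same ordering, say nonincreasing, for all matrices). Stabilizing means that $A-BB^\top\widehat{\mathcal P}_{\mathrm c}$ has all eigenvalues in the open left half plane. A maximal solution $X_{\max}$ is a solution with $X\preceq X_{\max}$ (Loewner order) for every solution $X=X^\top\succeq0$ of the KYP linear matrix inequality; it exists for the systems considered. Each solution $X=X^\top\succ0$ of the inequality gives an equivalent port-Hamiltonian representation $A=(J_X-R_X)X$, $C=B^\top X$ with $J_X=\frac12(AX^{-1}-X^{-1}A^\top)$ and $R_X=-\frac12(AX^{-1}+X^{-1}A^\top)\succeq0$; $X=Q$ is the original representation. For the representation $X$, the filter Riccati equation $A\widehat{\mathcal P}_{\mathrm f}+\widehat{\mathcal P}_{\mathrm f}A^\top-\widehat{\mathcal P}_{\mathrm f}C^\top C\widehat{\mathcal P}_{\mathrm f}+BB^\top+2R_X=0$ has stabilizing solution $\widehat{\mathcal P}_{\mathrm f}=X^{-1}$, and $\theta_i(X)=\sigma_i/\sqrt{1+\sigma_i^2}$ where $\sigma_i=\sqrt{\lambda_i(X^{-1}\widehat{\mathcal P}_{\mathrm c})}$; the quantity $2\sum_{i=r+1}^n\theta_i(X)$ is the a priori $\mathcal H_\infty$-error bound for the right coprime factors of the order-$r$ model obtained by balanced truncation with respect to $\widehat{\mathcal P}_{\mathrm c}$ and $\widehat{\mathcal P}_{\mathrm f}=X^{-1}$. *)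

theory Defs
  imports "HOL-Analysis.Analysis" "HOL-Computational_Algebra.Computational_Algebra"
begin

text \<open>
  An \<open>n \<times> m\<close> matrix has type \<^typ>\<open>real ^ 'm ^ 'n\<close>, with \<open>n = CARD('n)\<close> and \<open>m = CARD('m)\<close>.
\<close>

subsection \<open>Eigenvalues and definiteness\<close>

definition charpoly :: "real ^ 'n ^ 'n \<Rightarrow> real poly" where
  "charpoly M = det (\<chi> i j. (if i = j then [:0, 1:] else 0) - [: M $ i $ j :])"

text \<open>
  The \<open>i\<close>-th eigenvalue of a symmetric matrix in nonincreasing order, counted with
  multiplicity; meaningful for \<open>1 \<le> i \<le> n\<close> (indices start at 1).
\<close>

definition nth_eigenvalue :: "nat \<Rightarrow> real ^ 'n ^ 'n \<Rightarrow> real" where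
  "nth_eigenvalue i M = rev (sorted_list_of_multiset (proots (charpoly M))) ! (i - 1)"

definition complex_eigenvalue :: "real ^ 'n ^ 'n \<Rightarrow> complex \<Rightarrow> bool" where
  "complex_eigenvalue M z \<longleftrightarrow>
     (\<exists>v :: complex ^ 'n. v \<noteq> 0 \<and> (\<chi> i j. complex_of_real (M $ i $ j)) *v v = z *s v)"

definition hurwitz :: "real ^ 'n ^ 'n \<Rightarrow> bool" where
  "hurwitz M \<longleftrightarrow> (\<forall>z. complex_eigenvalue M z \<longrightarrow> Re z < 0)"

definition sym_matrix :: "real ^ 'n ^ 'n \<Rightarrow> bool" where
  "sym_matrix M \<longleftrightarrow> transpose M = M"

definition pos_semidef :: "real ^ 'n ^ 'n \<Rightarrow> bool" where
  "pos_semidef M \<longleftrightarrow> sym_matrix M \<and> (\<forall>x. 0 \<le> x \<bullet> (M *v x))"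

definition pos_def :: "real ^ 'n ^ 'n \<Rightarrow> bool" where
  "pos_def M \<longleftrightarrow> sym_matrix M \<and> (\<forall>x. x \<noteq> 0 \<longrightarrow> 0 < x \<bullet> (M *v x))"

definition loewner_le :: "real ^ 'n ^ 'n \<Rightarrow> real ^ 'n ^ 'n \<Rightarrow> bool" where
  "loewner_le X Y \<longleftrightarrow> pos_semidef (Y - X)"

text \<open>The order on the index type stands for the order of \<open>1, \<dots>, n\<close>.\<close>

definition cholesky_decomposition ::
    "real ^ ('n :: {finite, linorder}) ^ ('n :: {finite, linorder}) \<Rightarrow>
     real ^ ('n :: {finite, linorder}) ^ ('n :: {finite, linorder}) \<Rightarrow> bool" where
  "cholesky_decomposition P L \<longleftrightarrow>
     P = transpose L ** L \<and> (\<forall>i j. j < i \<longrightarrow> L $ i $ j = 0) \<and> (\<forall>i. 0 < L $ i $ i)"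

subsection \<open>Controllability and observability\<close>

definition controllable :: "real ^ 'n ^ 'n \<Rightarrow> real ^ 'm ^ 'n \<Rightarrow> bool" where
  "controllable A B \<longleftrightarrow>
     (\<forall>x\<^sub>0 x\<^sub>1. \<exists>T > 0. \<exists>u x.
        continuous_on {0..T} u \<and> x 0 = x\<^sub>0 \<and> x T = x\<^sub>1 \<and>
        (\<forall>t \<in> {0..T}. (x has_vector_derivative (A *v x t + B *v u t)) (at t within {0..T})))"

text \<open>By linearity it suffices to compare the outputs for the input \<open>u = 0\<close>.\<close>

definition observable :: "real ^ 'n ^ 'n \<Rightarrow> real ^ 'n ^ 'm \<Rightarrow> bool" where
  "observable A C \<longleftrightarrow>
     (\<forall>x y.
        (\<forall>t \<in> {0..}. (x has_vector_derivative (A *v x t)) (at t within {0..})) \<and>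
        (\<forall>t \<in> {0..}. (y has_vector_derivative (A *v y t)) (at t within {0..})) \<and>
        (\<forall>t \<in> {0..}. C *v x t = C *v y t) \<longrightarrow> x 0 = y 0)"

subsection \<open>Port-Hamiltonian systems and the KYP inequality\<close>

definition ph_representation ::
    "real ^ 'n ^ 'n \<Rightarrow> real ^ 'm ^ 'n \<Rightarrow> real ^ 'n ^ 'm \<Rightarrow>
     real ^ 'n ^ 'n \<Rightarrow> real ^ 'n ^ 'n \<Rightarrow> real ^ 'n ^ 'n \<Rightarrow> bool" where
  "ph_representation A B C J R Q \<longleftrightarrow>
     transpose J = - J \<and> pos_semidef R \<and> pos_def Q \<and>
     A = (J - R) ** Q \<and> C = transpose B ** Q"

definition block_matrix ::
    "real ^ 'n ^ 'n \<Rightarrow> real ^ 'm ^ 'n \<Rightarrow> real ^ 'n ^ 'm \<Rightarrow> real ^ 'm ^ 'm \<Rightarrow>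
     real ^ ('n + 'm) ^ ('n + 'm)" where
  "block_matrix M11 M12 M21 M22 = (\<chi> i j.
     (case i of
        Inl a \<Rightarrow> (case j of Inl b \<Rightarrow> M11 $ a $ b | Inr b \<Rightarrow> M12 $ a $ b)
      | Inr a \<Rightarrow> (case j of Inl b \<Rightarrow> M21 $ a $ b | Inr b \<Rightarrow> M22 $ a $ b)))"

definition kyp_solution ::
    "real ^ 'n ^ 'n \<Rightarrow> real ^ 'm ^ 'n \<Rightarrow> real ^ 'n ^ 'm \<Rightarrow> real ^ 'n ^ 'n \<Rightarrow> bool" where
  "kyp_solution A B C X \<longleftrightarrow>
     sym_matrix X \<and>
     pos_semidef (block_matrix (- (transpose A ** X) - X ** A) (transpose C - X ** B)
                               (C - transpose B ** X) 0)"

definition maximal_kyp_solution ::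
    "real ^ 'n ^ 'n \<Rightarrow> real ^ 'm ^ 'n \<Rightarrow> real ^ 'n ^ 'm \<Rightarrow> real ^ 'n ^ 'n \<Rightarrow> bool" where
  "maximal_kyp_solution A B C Xmax \<longleftrightarrow>
     kyp_solution A B C Xmax \<and>
     (\<forall>X. pos_semidef X \<and> kyp_solution A B C X \<longrightarrow> loewner_le X Xmax)"

definition J_of :: "real ^ 'n ^ 'n \<Rightarrow> real ^ 'n ^ 'n \<Rightarrow> real ^ 'n ^ 'n" where
  "J_of A X = (1 / 2) *\<^sub>R (A ** matrix_inv X - matrix_inv X ** transpose A)"

definition R_of :: "real ^ 'n ^ 'n \<Rightarrow> real ^ 'n ^ 'n \<Rightarrow> real ^ 'n ^ 'n" where
  "R_of A X = - ((1 / 2) *\<^sub>R (A ** matrix_inv X + matrix_inv X ** transpose A))"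

subsection \<open>Control Riccati equation and error bound\<close>

definition stabilizing_riccati_solution ::
    "real ^ 'n ^ 'n \<Rightarrow> real ^ 'm ^ 'n \<Rightarrow> real ^ 'n ^ 'm \<Rightarrow> real ^ 'n ^ 'n \<Rightarrow> bool" where
  "stabilizing_riccati_solution A B C P \<longleftrightarrow>
     sym_matrix P \<and>
     transpose A ** P + P ** A - P ** B ** transpose B ** P + transpose C ** C = 0 \<and>
     hurwitz (A - B ** transpose B ** P)"

definition theta ::
    "real ^ 'n ^ 'n \<Rightarrow> real ^ 'n ^ 'n \<Rightarrow> nat \<Rightarrow> real ^ 'n ^ 'n \<Rightarrow> real" where
  "theta P L i X = sqrt (nth_eigenvalue i (L ** matrix_inv (X + P) ** transpose L))"

definition error_bound ::
    "real ^ 'n ^ 'n \<Rightarrow> real ^ 'n ^ 'n \<Rightarrow> nat \<Rightarrow> real ^ 'n ^ 'n \<Rightarrow> real" where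
  "error_bound P L r X = 2 * (\<Sum>i = r + 1..CARD('n). theta P L i X)"

end

theory Submission
  imports Defs
begin

text \<open>
  The off-diagonal block of the KYP inequality must vanish because the lower right block is
  zero; hence its positive definite solutions are exactly the port-Hamiltonian representations.
  If \<open>X \<preceq> X\<^sub>m\<^sub>a\<^sub>x\<close>, then \<open>(X\<^sub>m\<^sub>a\<^sub>x + P)\<^sup>-\<^sup>1 \<preceq> (X + P)\<^sup>-\<^sup>1\<close> because inversion is antitone, congruence
  with \<open>L\<close> preserves the order, and eigenvalues are monotone in the Loewner order. The last fact
  comes from comparing dimensions: the span of the eigenvectors of the smaller matrix with
  eigenvalue \<open>\<ge> t\<close> meets the span of those of the larger matrix with eigenvalue \<open>< t\<close> only in \<open>0\<close>.
\<close>

subsection \<open>Spectral theorem for real symmetric matrices\<close>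

lemma inner_matrix_sym:
  fixes M :: "real ^ 'n ^ 'n"
  assumes "sym_matrix M"
  shows "x \<bullet> (M *v y) = y \<bullet> (M *v x)"
  using assms by (metis dot_lmul_matrix inner_commute sym_matrix_def transpose_matrix_vector)

text \<open>For small \<open>t\<close> the linear term dominates, so a nonzero \<open>p\<close>
  would force a negative value. This first-variation argument serves twice: for the Rayleigh
  quotient and for the KYP block matrix.\<close>

lemma linear_coeff_zero_if_quadratic_nonneg:
  fixes p q :: real
  assumes "\<And>t. 0 \<le> 2 * t * p + t\<^sup>2 * q"
  shows "p = 0"
proof (rule ccontr)
  assume "p \<noteq> 0"
  \<comment> \<open>The step size is chosen so that \<open>s * q\<close> stays below 2; the test
    point is then \<open>t = - s * p\<close>, against the sign of \<open>p\<close>.\<close>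
  define s where "s = 1 / (\<bar>q\<bar> + 1)"
  have "s > 0" "s * q \<le> 1" by (auto simp: s_def field_simps)
  have "2 * (- s * p) * p + (- s * p)\<^sup>2 * q = s * p\<^sup>2 * (s * q - 2)"
    by (simp add: power2_eq_square algebra_simps)
  also have "\<dots> < 0"
    using \<open>s > 0\<close> \<open>s * q \<le> 1\<close> \<open>p \<noteq> 0\<close> by (intro mult_pos_neg) auto
  finally show False using assms[of "- s * p"] by linarith
qed

text \<open>A maximizer of the quadratic form on the compact unit sphere of \<open>S\<close> is an
  eigenvector, because the first variation vanishes in all directions of \<open>S\<close> and
  invariance puts the residual \<open>c *\<^sub>R v - M *v v\<close> among these directions.\<close>

lemma sym_matrix_eigenvector_in_subspace:
  fixes M :: "real ^ 'n ^ 'n"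
  assumes M: "sym_matrix M" and S: "subspace S" and inv: "\<And>x. x \<in> S \<Longrightarrow> M *v x \<in> S"
    and "S \<noteq> {0}"
  obtains v c where "v \<in> S" "norm v = 1" "M *v v = c *\<^sub>R v"
proof -
  let ?K = "sphere 0 1 \<inter> S"
  obtain x where x: "x \<in> S" "x \<noteq> 0"
    using \<open>S \<noteq> {0}\<close> S subspace_0 by blast
  have "x /\<^sub>R norm x \<in> ?K"
    using x S by (auto intro: subspace_scale)
  moreover have "compact ?K"
    using closed_subspace[OF S] by (intro compact_Int_closed compact_sphere)
  moreover have "continuous_on ?K (\<lambda>x. x \<bullet> (M *v x))"
    by (intro continuous_intros matrix_vector_mult_linear_continuous_on)
  ultimately obtain v where v: "v \<in> ?K" and max: "\<And>y. y \<in> ?K \<Longrightarrow> y \<bullet> (M *v y) \<le> v \<bullet> (M *v v)"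
    using continuous_attains_sup[of ?K "\<lambda>x. x \<bullet> (M *v x)"] by blast
  define c where "c = v \<bullet> (M *v v)"
  have nonneg: "0 \<le> c * (y \<bullet> y) - y \<bullet> (M *v y)" if y: "y \<in> S" for y
  proof (cases "y = 0")
    case False
    then have "y /\<^sub>R norm y \<in> ?K"
      using y S by (auto intro: subspace_scale)
    from max[OF this] have "y \<bullet> (M *v y) / (norm y)\<^sup>2 \<le> c"
      by (simp add: c_def matrix_vector_mult_scaleR power2_eq_square field_simps)
    with False show ?thesis
      by (simp add: field_simps power2_norm_eq_inner)
  qed simp
  \<comment> \<open>The form \<open>c * (y \<bullet> y) - y \<bullet> (M *v y)\<close> is
    nonnegative on \<open>S\<close> and zero at \<open>v\<close>. Moving from \<open>v\<close> along
    the residual \<open>w\<close> has linear coefficient \<open>w \<bullet> w\<close>, which must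
    therefore vanish.\<close>
  define w where "w = c *\<^sub>R v - M *v v"
  have "w \<in> S"
    using v S inv by (auto simp: w_def intro: subspace_diff subspace_scale)
  have vv: "v \<bullet> v = 1"
    using v by (simp add: dot_square_norm)
  have "w \<bullet> w = 0"
  proof (rule linear_coeff_zero_if_quadratic_nonneg)
    fix t
    have "0 \<le> c * ((v + t *\<^sub>R w) \<bullet> (v + t *\<^sub>R w)) - (v + t *\<^sub>R w) \<bullet> (M *v (v + t *\<^sub>R w))"
      using v \<open>w \<in> S\<close> S by (intro nonneg) (auto intro: subspace_add subspace_scale)
    also have "\<dots> = c * (v \<bullet> v) - v \<bullet> (M *v v) + 2 * t * (c * (w \<bullet> v) - w \<bullet> (M *v v))
        + t\<^sup>2 * (c * (w \<bullet> w) - w \<bullet> (M *v w))"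
      using inner_matrix_sym[OF M, of v w]
      by (simp add: algebra_simps matrix_vector_right_distrib matrix_vector_mult_scaleR
          inner_add_left inner_add_right power2_eq_square inner_commute)
    also have "c * (w \<bullet> v) - w \<bullet> (M *v v) = w \<bullet> w"
      by (metis inner_diff_right inner_scaleR_right w_def)
    finally show "0 \<le> 2 * t * (w \<bullet> w) + t\<^sup>2 * (c * (w \<bullet> w) - w \<bullet> (M *v w))"
      using vv by (simp add: c_def)
  qed
  then have "M *v v = c *\<^sub>R v" by (simp add: w_def)
  with v that show ?thesis by auto
qed

text \<open>Induction on the dimension: split off a unit eigenvector \<open>v\<close>. Its
  orthogonal complement \<open>T\<close> in \<open>S\<close> is again invariant, since symmetry
  moves \<open>M\<close> onto \<open>v\<close>.\<close>

lemma sym_matrix_orthonormal_eigenbasis_subspace: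
  fixes M :: "real ^ 'n ^ 'n"
  assumes M: "sym_matrix M" and S: "subspace S" and inv: "\<And>x. x \<in> S \<Longrightarrow> M *v x \<in> S"
  shows "\<exists>E. span E = S \<and> pairwise orthogonal E \<and> (\<forall>v\<in>E. norm v = 1 \<and> (\<exists>c. M *v v = c *\<^sub>R v))"
  using S inv
proof (induction "dim S" arbitrary: S rule: less_induct)
  case less
  show ?case
  proof (cases "S = {0}")
    case True
    then show ?thesis by (intro exI[of _ "{}"]) (auto simp: pairwise_def)
  next
    case False
    obtain v c where v: "v \<in> S" "norm v = 1" "M *v v = c *\<^sub>R v"
      using sym_matrix_eigenvector_in_subspace[OF M less.prems(1) less.prems(2) False] by blast
    have vv: "v \<bullet> v = 1" using v by (simp add: dot_square_norm)
    define T where "T = {x \<in> S. v \<bullet> x = 0}"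
    have T: "subspace T"
      using less.prems(1) by (auto simp: T_def subspace_def inner_add_right)
    have "v \<notin> T" using vv by (simp add: T_def)
    moreover have "T \<subseteq> S" by (auto simp: T_def)
    ultimately have "T \<subset> S" using v(1) by blast
    then have "dim T < dim S"
      using T less.prems(1) by (metis dim_psubset span_eq_iff)
    moreover have "M *v x \<in> T" if "x \<in> T" for x
      using that less.prems(2) v(3) inner_matrix_sym[OF M, of v x]
      by (simp add: T_def inner_commute)
    ultimately obtain E where E: "span E = T" "pairwise orthogonal E"
        "\<forall>v\<in>E. norm v = 1 \<and> (\<exists>c. M *v v = c *\<^sub>R v)"
      using less.hyps[of T] T by blast
    have "E \<subseteq> T" using E(1) span_superset by blast
    have "span (insert v E) = S"
    proof
      show "span (insert v E) \<subseteq> S"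
        using v \<open>E \<subseteq> T\<close> less.prems(1) by (intro span_minimal) (auto simp: T_def)
      show "S \<subseteq> span (insert v E)"
      proof
        fix x assume "x \<in> S"
        then have "x - (v \<bullet> x) *\<^sub>R v \<in> span E"
          using v vv less.prems(1) unfolding E(1) T_def
          by (auto simp: inner_diff_right intro: subspace_diff subspace_scale)
        then show "x \<in> span (insert v E)" using span_insert by blast
      qed
    qed
    moreover have "pairwise orthogonal (insert v E)"
      using E(2) \<open>E \<subseteq> T\<close>
      by (auto simp: pairwise_insert orthogonal_def T_def inner_commute)
    ultimately show ?thesis
      using E(3) v by (intro exI[of _ "insert v E"]) auto
  qed
qed

text \<open>Indexing by the dimension type fixes the number of vectors at \<open>CARD('n)\<close>,
  so orthonormality alone makes \<open>e\<close> a basis, and \<open>d\<close> lists the eigenvalues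
  with multiplicity.\<close>

definition eigenbasis :: "real ^ 'n ^ 'n \<Rightarrow> ('n \<Rightarrow> real ^ 'n) \<Rightarrow> ('n \<Rightarrow> real) \<Rightarrow> bool" where
  "eigenbasis M e d \<longleftrightarrow>
     (\<forall>i j. e i \<bullet> e j = (if i = j then 1 else 0)) \<and> (\<forall>i. M *v e i = d i *\<^sub>R e i)"

lemma sym_matrix_eigenbasis:
  fixes M :: "real ^ 'n ^ 'n"
  assumes "sym_matrix M"
  obtains e d where "eigenbasis M e d"
proof -
  obtain E where E: "span E = UNIV" "pairwise orthogonal E"
      "\<forall>v\<in>E. norm v = 1 \<and> (\<exists>c. M *v v = c *\<^sub>R v)"
    using sym_matrix_orthonormal_eigenbasis_subspace[OF assms, of UNIV] by auto
  have "independent E"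
    using E by (intro pairwise_orthogonal_independent) auto
  then have "finite E" "card E = dim (span E)"
    by (simp_all add: independent_imp_finite dim_eq_card_independent)
  then have "finite E" "card E = CARD('n)"
    by (simp_all add: E(1) del: dim_span)
  then obtain e where e: "bij_betw e (UNIV :: 'n set) E"
    using finite_same_card_bij[of "UNIV :: 'n set" E] by auto
  then have eE: "e i \<in> E" for i by (auto simp: bij_betw_def)
  then have "\<forall>i. \<exists>c. M *v e i = c *\<^sub>R e i"
    using E(3) by blast
  then obtain d where "M *v e i = d i *\<^sub>R e i" for i
    by metis
  moreover have "e i \<bullet> e j = (if i = j then 1 else 0)" for i j
  proof (cases "i = j")
    case True
    then show ?thesis using E(3) eE[of j] by (simp add: dot_square_norm)
  next
    case False
    then have "e i \<noteq> e j" using e by (auto simp: bij_betw_def inj_def)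
    then show ?thesis
      using False E(2) eE unfolding pairwise_def orthogonal_def by auto
  qed
  ultimately have "eigenbasis M e d" by (simp add: eigenbasis_def)
  then show ?thesis by (rule that)
qed

section \<open>Expansions, quadratic forms and characteristic polynomial in an orthonormal
  eigenbasis\<close>

context
  fixes M :: "real ^ 'n ^ 'n" and e d
  assumes basis: "eigenbasis M e d"
begin

text \<open>With the \<open>e k\<close> as rows of \<open>U\<close>, orthonormality says
  \<open>U ** transpose U = mat 1\<close>. A one-sided inverse of a square matrix is two-sided, and
  the other product is the resolution of the identity.\<close>

lemma eigenbasis_resolution: "(\<Sum>k\<in>UNIV. e k $ i * e k $ j) = (if i = j then 1 else 0)"
proof -
  define U :: "real ^ 'n ^ 'n" where "U = (\<chi> k. e k)"
  have "U ** transpose U = mat 1"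
    using basis
    by (simp add: U_def eigenbasis_def vec_eq_iff matrix_matrix_mult_def transpose_def mat_def
        inner_vec_def)
  then have "transpose U ** U = mat 1"
    by (simp add: matrix_left_right_inverse)
  then have "(transpose U ** U) $ i $ j = (mat 1 :: real ^ 'n ^ 'n) $ i $ j" by simp
  then show ?thesis
    by (simp add: U_def matrix_matrix_mult_def transpose_def mat_def)
qed

lemma eigenbasis_decomposition: "M $ i $ j = (\<Sum>k\<in>UNIV. d k * e k $ i * e k $ j)"
proof -
  have eig: "(\<Sum>l\<in>UNIV. M $ i $ l * e k $ l) = d k * e k $ i" for k
    using basis by (auto simp: eigenbasis_def vec_eq_iff matrix_vector_mult_def)
  have "(\<Sum>k\<in>UNIV. d k * e k $ i * e k $ j) = (\<Sum>k\<in>UNIV. \<Sum>l\<in>UNIV. M $ i $ l * (e k $ l * e k $ j))"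
    by (simp add: eig[symmetric] sum_distrib_right mult.assoc)
  also have "\<dots> = (\<Sum>l\<in>UNIV. \<Sum>k\<in>UNIV. M $ i $ l * (e k $ l * e k $ j))"
    by (rule sum.swap)
  also have "\<dots> = M $ i $ j"
    by (simp add: sum_distrib_left[symmetric] eigenbasis_resolution if_distrib cong: if_cong)
  finally show ?thesis by simp
qed

lemma eigenbasis_expansion: "x = (\<Sum>k\<in>UNIV. (x \<bullet> e k) *\<^sub>R e k)"
proof -
  have "(\<Sum>k\<in>UNIV. (\<Sum>i\<in>UNIV. x $ i * e k $ i) * e k $ j) = x $ j" for j
  proof -
    have "(\<Sum>k\<in>UNIV. (\<Sum>i\<in>UNIV. x $ i * e k $ i) * e k $ j)
        = (\<Sum>k\<in>UNIV. \<Sum>i\<in>UNIV. x $ i * (e k $ i * e k $ j))"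
      by (simp add: sum_distrib_right mult.assoc)
    also have "\<dots> = (\<Sum>i\<in>UNIV. \<Sum>k\<in>UNIV. x $ i * (e k $ i * e k $ j))"
      by (rule sum.swap)
    also have "\<dots> = x $ j"
      by (simp add: sum_distrib_left[symmetric] eigenbasis_resolution if_distrib cong: if_cong)
    finally show ?thesis .
  qed
  then show ?thesis by (simp add: vec_eq_iff inner_vec_def)
qed

text \<open>Parseval's identity.\<close>

lemma eigenbasis_norm: "x \<bullet> x = (\<Sum>k\<in>UNIV. (x \<bullet> e k)\<^sup>2)"
  by (subst (2) eigenbasis_expansion[of x]) (simp add: inner_sum_right power2_eq_square)

lemma eigenbasis_quadratic_form: "x \<bullet> (M *v x) = (\<Sum>k\<in>UNIV. d k * (x \<bullet> e k)\<^sup>2)"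
proof -
  have eig: "M *v e k = d k *\<^sub>R e k" for k
    using basis by (simp add: eigenbasis_def)
  have "M *v x = (\<Sum>k\<in>UNIV. (x \<bullet> e k) *\<^sub>R (M *v e k))"
    by (subst eigenbasis_expansion[of x])
      (simp add: linear_sum[OF matrix_vector_mul_linear] matrix_vector_mult_scaleR)
  then show ?thesis
    by (simp add: eig inner_sum_right power2_eq_square mult_ac)
qed

lemma eigenbasis_inner_zero_outside_span:
  assumes "x \<in> span (e ` I)" "j \<notin> I"
  shows "x \<bullet> e j = 0"
  using assms(1)
proof (induction rule: span_induct)
  case base
  show ?case by (auto simp: subspace_def inner_add_left)
next
  case (step x)
  then show ?case using assms(2) basis by (auto simp: eigenbasis_def)
qed

lemma eigenbasis_dim_span: "dim (span (e ` I)) = card I"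
proof -
  have orth: "e i \<bullet> e j = (if i = j then 1 else 0)" for i j
    using basis by (simp add: eigenbasis_def)
  have "inj e"
    by (rule injI) (metis orth zero_neq_one)
  moreover have "independent (e ` I)"
  proof (rule pairwise_orthogonal_independent)
    show "pairwise orthogonal (e ` I)"
      by (auto simp: pairwise_def orthogonal_def orth)
    show "0 \<notin> e ` I"
      using orth by (metis imageE inner_zero_left zero_neq_one)
  qed
  ultimately show ?thesis
    by (simp add: dim_eq_card_independent card_image inj_on_subset)
qed

text \<open>Orthogonal diagonalization over the polynomial ring: with the entries of
  \<open>U\<close> lifted to constants, the characteristic matrix equals
  \<open>transpose U ** (D ** U)\<close>, and the determinants of \<open>U\<close> and its transpose
  multiply to 1.\<close>

lemma eigenbasis_charpoly: "charpoly M = (\<Prod>k\<in>UNIV. [:- d k, 1:])"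
proof -
  define U :: "real poly ^ 'n ^ 'n" where "U = (\<chi> k i. [:e k $ i:])"
  define D :: "real poly ^ 'n ^ 'n" where "D = (\<chi> k l. if k = l then [:- d k, 1:] else 0)"
  have const_sum: "(\<Sum>k\<in>UNIV. [:f k:]) = [:\<Sum>k\<in>UNIV. f k:]" for f :: "'n \<Rightarrow> real"
    by (simp add: poly_eq_iff coeff_sum coeff_pCons split: nat.splits)
  have "transpose U ** U = mat 1"
    by (simp add: U_def vec_eq_iff matrix_matrix_mult_def transpose_def mat_def const_sum
        eigenbasis_resolution)
  then have "det (transpose U) * det U = 1"
    by (metis det_I det_mul)
  have DU: "D ** U = (\<chi> k j. [:- d k, 1:] * U $ k $ j)"
    by (simp add: D_def vec_eq_iff matrix_matrix_mult_def if_distribR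
        if_distrib[of "\<lambda>x. x * _"] cong: if_cong)
  have "(transpose U ** (D ** U)) $ i $ j
      = (if i = j then [:0, 1:] else 0) - [:M $ i $ j:]" for i j
  proof -
    have "(transpose U ** (D ** U)) $ i $ j
        = (\<Sum>k\<in>UNIV. [:e k $ i:] * ([:- d k, 1:] * [:e k $ j:]))"
      unfolding DU by (simp add: U_def matrix_matrix_mult_def transpose_def)
    also have "\<dots> = (\<Sum>k\<in>UNIV. [:0, 1:] * [:e k $ i * e k $ j:] - [:d k * e k $ i * e k $ j:])"
      by (intro sum.cong) (auto simp: algebra_simps)
    also have "\<dots> = [:0, 1:] * [:\<Sum>k\<in>UNIV. e k $ i * e k $ j:]
        - [:\<Sum>k\<in>UNIV. d k * e k $ i * e k $ j:]"
      by (simp only: sum_subtractf sum_distrib_left[symmetric] const_sum)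
    also have "\<dots> = (if i = j then [:0, 1:] else 0) - [:M $ i $ j:]"
      by (simp add: eigenbasis_resolution eigenbasis_decomposition)
    finally show ?thesis .
  qed
  then have "charpoly M = det (transpose U ** (D ** U))"
    unfolding charpoly_def by (intro arg_cong[of _ _ det]) (simp add: vec_eq_iff)
  also have "\<dots> = det D"
    using \<open>det (transpose U) * det U = 1\<close> by (simp add: det_mul mult_ac)
  also have "\<dots> = (\<Prod>k\<in>UNIV. [:- d k, 1:])"
    by (subst det_diagonal) (auto simp: D_def)
  finally show ?thesis .
qed

text \<open>This ties the eigenvalues defined through polynomial roots to the family
  \<open>d\<close>, so that they can be studied by quadratic forms.\<close>

lemma eigenbasis_proots_charpoly: "proots (charpoly M) = image_mset d (mset_set UNIV)"
proof -
  have "proots (\<Prod>k\<in>K. [:- d k, 1:]) = image_mset d (mset_set K)" if "finite K" for K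
    using that
  proof (induction K)
    case (insert k K)
    have "(\<Prod>k\<in>K. [:- d k, 1:]) \<noteq> 0"
      using insert.hyps by (simp add: prod_zero_iff)
    with insert show ?case
      by (simp add: proots_mult del: mult_pCons_left)
  qed simp
  then show ?thesis by (simp add: eigenbasis_charpoly)
qed

end

subsection \<open>Monotonicity of eigenvalues\<close>

text \<open>Weyl monotonicity in counting form, which needs no ordering of \<open>d\<close> and
  \<open>d'\<close>. On \<open>?V\<close> the form of \<open>M\<close> is at least
  \<open>t * (x \<bullet> x)\<close>; on nonzero vectors of \<open>?W\<close> the form of
  \<open>N\<close> is strictly less.\<close>

lemma card_eigenvalues_ge_mono:
  fixes M N :: "real ^ 'n ^ 'n"
  assumes M: "eigenbasis M e d" and N: "eigenbasis N e' d'"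
    and le: "\<And>x. x \<bullet> (M *v x) \<le> x \<bullet> (N *v x)"
  shows "card {i. t \<le> d i} \<le> card {i. t \<le> d' i}"
proof -
  let ?V = "span (e ` {i. t \<le> d i})" and ?W = "span (e' ` {i. \<not> t \<le> d' i})"
  have "x = 0" if V: "x \<in> ?V" and W: "x \<in> ?W" for x
  proof (rule ccontr)
    assume "x \<noteq> 0"
    have "t * (x \<bullet> x) = (\<Sum>k\<in>UNIV. t * (x \<bullet> e k)\<^sup>2)"
      by (simp add: eigenbasis_norm[OF M] sum_distrib_left)
    also have "\<dots> \<le> (\<Sum>k\<in>UNIV. d k * (x \<bullet> e k)\<^sup>2)"
      using eigenbasis_inner_zero_outside_span[OF M V]
      by (intro sum_mono) (force intro: mult_right_mono)
    also have "\<dots> = x \<bullet> (M *v x)"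
      by (simp add: eigenbasis_quadratic_form[OF M])
    also have "\<dots> \<le> x \<bullet> (N *v x)" by (rule le)
    also have "\<dots> = (\<Sum>k\<in>UNIV. d' k * (x \<bullet> e' k)\<^sup>2)"
      by (simp add: eigenbasis_quadratic_form[OF N])
    also have "\<dots> < (\<Sum>k\<in>UNIV. t * (x \<bullet> e' k)\<^sup>2)"
    proof (rule sum_strict_mono_ex1)
      have zero: "x \<bullet> e' k = 0" if "t \<le> d' k" for k
        using eigenbasis_inner_zero_outside_span[OF N W, of k] that by simp
      then show "\<forall>k\<in>UNIV. d' k * (x \<bullet> e' k)\<^sup>2 \<le> t * (x \<bullet> e' k)\<^sup>2"
        by (metis linear mult_right_mono mult_zero_right order_refl power_zero_numeral zero_le_power2)
      \<comment> \<open>Strictness: a nonzero \<open>x\<close> has some nonzero coordinate, and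
        inside \<open>?W\<close> such a coordinate can only belong to an eigenvalue below
        \<open>t\<close>.\<close>
      obtain k where k: "x \<bullet> e' k \<noteq> 0"
        using eigenbasis_norm[OF N, of x] \<open>x \<noteq> 0\<close>
        by (metis (mono_tags, lifting) inner_eq_zero_iff sum.neutral zero_power2)
      then have "d' k < t" using zero[of k] by force
      with k show "\<exists>k\<in>UNIV. d' k * (x \<bullet> e' k)\<^sup>2 < t * (x \<bullet> e' k)\<^sup>2"
        by (intro bexI[of _ k]) simp_all
    qed simp
    also have "\<dots> = t * (x \<bullet> x)"
      by (simp add: eigenbasis_norm[OF N] sum_distrib_left)
    finally show False by simp
  qed
  then have "?V \<inter> ?W = {0}" by (auto simp: span_zero)
  \<comment> \<open>A trivial intersection makes the dimensions of \<open>?V\<close> and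
    \<open>?W\<close> add up to at most \<open>CARD('n)\<close>; the same number splits as the two
    index counts for \<open>d'\<close>, and the common summand cancels.\<close>
  then have "card {i. t \<le> d i} + card {i. \<not> t \<le> d' i} = dim {x + y |x y. x \<in> ?V \<and> y \<in> ?W}"
    using dim_sums_Int[of ?V ?W]
    by (simp add: eigenbasis_dim_span[OF M] eigenbasis_dim_span[OF N] del: dim_span)
  also have "\<dots> \<le> CARD('n)"
    using dim_subset_UNIV[of "{x + y |x y. x \<in> ?V \<and> y \<in> ?W}"] by simp
  also have "CARD('n) = card ({i. t \<le> d' i} \<union> {i. \<not> t \<le> d' i})"
    by (rule arg_cong[of _ _ card]) auto
  also have "\<dots> = card {i. t \<le> d' i} + card {i. \<not> t \<le> d' i}"
    by (intro card_Un_disjoint) auto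
  finally show ?thesis by simp
qed

text \<open>Converts counts into positions. Take \<open>t\<close> as entry \<open>k\<close> of the
  descending \<open>xs\<close>: counting from 0, at least \<open>k + 1\<close> entries of
  \<open>xs\<close> reach \<open>t\<close>, whereas a smaller entry \<open>k\<close> of
  \<open>ys\<close> would leave at most \<open>k\<close> entries there.\<close>

lemma nth_rev_sorted_mono:
  fixes xs ys :: "'a :: linorder list"
  assumes "sorted xs" "sorted ys" "length xs = length ys" "k < length xs"
    and count: "\<And>t. length (filter (\<lambda>x. t \<le> x) xs) \<le> length (filter (\<lambda>x. t \<le> x) ys)"
  shows "rev xs ! k \<le> rev ys ! k"
proof (rule ccontr)
  define t where "t = rev xs ! k"
  assume "\<not> rev xs ! k \<le> rev ys ! k"
  then have less: "rev ys ! k < t" by (simp add: t_def)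
  have desc: "sorted_wrt (\<ge>) (rev xs)" "sorted_wrt (\<ge>) (rev ys)"
    using assms by (simp_all add: sorted_wrt_rev)
  have "{..k} \<subseteq> {i. i < length (rev xs) \<and> t \<le> rev xs ! i}"
    using sorted_wrt_nth_less[OF desc(1)] assms(4) by (force simp: t_def le_less)
  then have "card {..k} \<le> card {i. i < length (rev xs) \<and> t \<le> rev xs ! i}"
    by (intro card_mono) auto
  then have "k < length (filter (\<lambda>x. t \<le> x) (rev xs))"
    by (simp add: length_filter_conv_card)
  moreover have "{i. i < length (rev ys) \<and> t \<le> rev ys ! i} \<subseteq> {..<k}"
  proof
    fix i assume i: "i \<in> {i. i < length (rev ys) \<and> t \<le> rev ys ! i}"
    show "i \<in> {..<k}"
    proof (rule ccontr)
      assume "i \<notin> {..<k}"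
      then have "rev ys ! i \<le> rev ys ! k"
        using i sorted_wrt_nth_less[OF desc(2), of k i] by (cases "i = k") auto
      then show False using i less by auto
    qed
  qed
  then have "card {i. i < length (rev ys) \<and> t \<le> rev ys ! i} \<le> card {..<k}"
    by (intro card_mono) auto
  then have "length (filter (\<lambda>x. t \<le> x) (rev ys)) \<le> k"
    by (simp add: length_filter_conv_card)
  ultimately show False
    using count[of t] by (simp add: rev_filter[symmetric])
qed

lemma nth_eigenvalue_mono:
  fixes M N :: "real ^ 'n ^ 'n"
  assumes M: "sym_matrix M" and N: "sym_matrix N" and "loewner_le M N"
    and i: "i \<in> {1..CARD('n)}"
  shows "nth_eigenvalue i M \<le> nth_eigenvalue i N"
proof -
  obtain e d where e: "eigenbasis M e d" using sym_matrix_eigenbasis[OF M] .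
  obtain e' d' where e': "eigenbasis N e' d'" using sym_matrix_eigenbasis[OF N] .
  have "0 \<le> x \<bullet> ((N - M) *v x)" for x
    using assms(3) by (simp add: loewner_le_def pos_semidef_def)
  then have le: "x \<bullet> (M *v x) \<le> x \<bullet> (N *v x)" for x
    by (simp add: matrix_vector_mult_diff_rdistrib inner_diff_right)
  have len: "length (sorted_list_of_multiset (image_mset f (mset_set (UNIV :: 'n set)))) = CARD('n)"
    for f :: "'n \<Rightarrow> real"
    by (metis mset_sorted_list_of_multiset size_image_mset size_mset size_mset_set)
  have cnt: "length (filter (\<lambda>x. t \<le> x) (sorted_list_of_multiset (image_mset f (mset_set (UNIV :: 'n set)))))
      = card {i. t \<le> f i}" for t and f :: "'n \<Rightarrow> real"
  proof -
    have "length (filter (\<lambda>x. t \<le> x) (sorted_list_of_multiset (image_mset f (mset_set (UNIV :: 'n set)))))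
      = size (filter_mset (\<lambda>x. t \<le> x) (image_mset f (mset_set UNIV)))"
      by (metis mset_filter mset_sorted_list_of_multiset size_mset)
    also have "\<dots> = card {i. t \<le> f i}"
      by (simp add: filter_mset_image_mset filter_mset_mset_set)
    finally show ?thesis .
  qed
  \<comment> \<open>The range of \<open>i\<close> makes \<open>i - 1\<close> a valid position in
    both lists of length \<open>CARD('n)\<close>.\<close>
  show ?thesis
    unfolding nth_eigenvalue_def eigenbasis_proots_charpoly[OF e] eigenbasis_proots_charpoly[OF e']
    using i card_eigenvalues_ge_mono[OF e e' le]
    by (intro nth_rev_sorted_mono) (auto simp: len cnt)
qed

subsection \<open>Positive definite matrices\<close>

lemma pos_def_imp_pos_semidef: "pos_def X \<Longrightarrow> pos_semidef X"
  unfolding pos_def_def pos_semidef_def by (metis inner_zero_left order_le_less)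

lemma pos_def_add_pos_semidef:
  assumes "pos_def X" "pos_semidef P"
  shows "pos_def (X + P)"
  unfolding pos_def_def
proof (intro conjI allI impI)
  show "sym_matrix (X + P)"
    using assms by (auto simp: pos_def_def pos_semidef_def sym_matrix_def transpose_def vec_eq_iff)
  show "0 < x \<bullet> ((X + P) *v x)" if "x \<noteq> 0" for x
    using assms that unfolding matrix_vector_mult_add_rdistrib inner_add_right
    by (intro add_pos_nonneg) (simp_all add: pos_def_def pos_semidef_def)
qed

text \<open>Supplies semidefiniteness of \<open>Pc\<close> from its Cholesky factorization.\<close>

lemma pos_semidef_gram:
  fixes L :: "real ^ 'n ^ 'm"
  shows "pos_semidef (transpose L ** L)"
proof -
  have "x \<bullet> ((transpose L ** L) *v x) = (L *v x) \<bullet> (L *v x)" for x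
    by (metis dot_lmul_matrix matrix_vector_mul_assoc transpose_matrix_vector transpose_transpose inner_commute)
  then show ?thesis
    by (simp add: pos_semidef_def sym_matrix_def matrix_transpose_mul)
qed

lemma pos_def_invertible:
  assumes "pos_def X"
  shows "invertible X"
proof -
  have "x = 0" if "X *v x = 0" for x
    using assms that unfolding pos_def_def by (metis inner_zero_right less_irrefl)
  then show ?thesis
    by (simp add: invertible_left_inverse matrix_left_invertible_ker)
qed

lemma pos_def_matrix_inv:
  fixes X :: "real ^ 'n ^ 'n"
  assumes "pos_def X"
  shows "X ** matrix_inv X = mat 1" "matrix_inv X ** X = mat 1"
  using someI_ex[OF pos_def_invertible[OF assms, unfolded invertible_def]]
  by (simp_all add: matrix_inv_def)

lemma sym_matrix_inv:
  fixes X :: "real ^ 'n ^ 'n"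
  assumes "pos_def X"
  shows "sym_matrix (matrix_inv X)"
proof -
  have "transpose (matrix_inv X) ** X = mat 1"
    using pos_def_matrix_inv(1)[OF assms] assms
    by (metis matrix_transpose_mul pos_def_def sym_matrix_def transpose_mat)
  then show ?thesis
    unfolding sym_matrix_def
    by (metis assms matrix_mul_assoc matrix_mul_lid matrix_mul_rid pos_def_matrix_inv(1))
qed

section \<open>Loewner order under inversion and congruence\<close>

lemma loewner_le_quadratic_form:
  "loewner_le X Y \<Longrightarrow> x \<bullet> (X *v x) \<le> x \<bullet> (Y *v x)"
  by (auto simp: loewner_le_def pos_semidef_def matrix_vector_mult_diff_rdistrib inner_diff_right)

lemma loewner_leI:
  "sym_matrix X \<Longrightarrow> sym_matrix Y \<Longrightarrow> (\<And>x. x \<bullet> (X *v x) \<le> x \<bullet> (Y *v x)) \<Longrightarrow> loewner_le X Y"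
  by (auto simp: loewner_le_def pos_semidef_def matrix_vector_mult_diff_rdistrib inner_diff_right
      sym_matrix_def transpose_def vec_eq_iff)

text \<open>Matrix square roots are avoided by expanding the nonnegative form of \<open>X\<close> at
  \<open>a - b\<close>, the difference of the two preimages of \<open>z\<close>, and bounding
  \<open>a \<bullet> (X *v a)\<close> by
  \<open>a \<bullet> (Y *v a) = a \<bullet> z\<close>.\<close>

lemma loewner_le_matrix_inv:
  fixes X Y :: "real ^ 'n ^ 'n"
  assumes X: "pos_def X" and Y: "pos_def Y" and le: "loewner_le X Y"
  shows "loewner_le (matrix_inv Y) (matrix_inv X)"
proof (rule loewner_leI)
  fix z
  define a b where "a = matrix_inv Y *v z" and "b = matrix_inv X *v z"
  have Ya: "Y *v a = z" and Xb: "X *v b = z"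
    using pos_def_matrix_inv[OF X] pos_def_matrix_inv[OF Y]
    by (simp_all add: a_def b_def matrix_vector_mul_assoc)
  have sym: "sym_matrix X" using X by (simp add: pos_def_def)
  have "0 \<le> (a - b) \<bullet> (X *v (a - b))"
    using pos_def_imp_pos_semidef[OF X] by (simp add: pos_semidef_def)
  also have "\<dots> = a \<bullet> (X *v a) - 2 * (a \<bullet> z) + b \<bullet> z"
    using inner_matrix_sym[OF sym, of b a]
    by (simp add: matrix_vector_mult_diff_distrib inner_diff_left inner_diff_right Xb)
  also have "\<dots> \<le> b \<bullet> z - a \<bullet> z"
    using loewner_le_quadratic_form[OF le, of a] by (simp add: Ya)
  finally show "z \<bullet> (matrix_inv Y *v z) \<le> z \<bullet> (matrix_inv X *v z)"
    by (simp add: a_def b_def inner_commute)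
qed (use X Y in \<open>simp_all add: sym_matrix_inv\<close>)

lemma sym_matrix_congruence: "sym_matrix M \<Longrightarrow> sym_matrix (L ** M ** transpose L)"
  by (simp add: sym_matrix_def matrix_transpose_mul matrix_mul_assoc)

lemma inner_congruence:
  fixes M :: "real ^ 'n ^ 'n" and L :: "real ^ 'n ^ 'm"
  shows "x \<bullet> ((L ** M ** transpose L) *v x) = (transpose L *v x) \<bullet> (M *v (transpose L *v x))"
  by (simp add: matrix_vector_mul_assoc[symmetric])
    (metis dot_lmul_matrix transpose_matrix_vector transpose_transpose)

lemma loewner_le_congruence:
  assumes "sym_matrix M" "sym_matrix N" "loewner_le M N"
  shows "loewner_le (L ** M ** transpose L) (L ** N ** transpose L)"
  using assms
  by (intro loewner_leI sym_matrix_congruence) (simp_all add: inner_congruence loewner_le_quadratic_form)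

lemma theta_antimono:
  fixes X Y P L :: "real ^ 'n ^ 'n"
  assumes X: "pos_def X" and Y: "pos_def Y" and P: "pos_semidef P" and "loewner_le X Y"
    and i: "i \<in> {1..CARD('n)}"
  shows "theta P L i Y \<le> theta P L i X"
proof -
  have XP: "pos_def (X + P)" and YP: "pos_def (Y + P)"
    using X Y P by (simp_all add: pos_def_add_pos_semidef)
  \<comment> \<open>The summand \<open>P\<close> cancels in the difference.\<close>
  have "loewner_le (X + P) (Y + P)"
    using \<open>loewner_le X Y\<close> by (simp add: loewner_le_def)
  then have "loewner_le (matrix_inv (Y + P)) (matrix_inv (X + P))"
    using XP YP by (intro loewner_le_matrix_inv)
  \<comment> \<open>Real \<open>sqrt\<close> is monotone on the whole line, so the eigenvalue
    comparison passes directly to the roots.\<close>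
  then show ?thesis
    unfolding theta_def using XP YP i
    by (intro real_sqrt_le_mono nth_eigenvalue_mono loewner_le_congruence sym_matrix_congruence
        sym_matrix_inv)
qed

subsection \<open>The KYP inequality and port-Hamiltonian representations\<close>

definition block_vector :: "real ^ 'n \<Rightarrow> real ^ 'm \<Rightarrow> real ^ ('n + 'm)" where
  "block_vector u v = (\<chi> i. case i of Inl a \<Rightarrow> u $ a | Inr b \<Rightarrow> v $ b)"

lemma block_vector_cases: obtains u v where "x = block_vector u v"
proof
  show "x = block_vector (\<chi> a. x $ Inl a) (\<chi> b. x $ Inr b)"
    by (simp add: block_vector_def vec_eq_iff split: sum.split)
qed

lemma sum_UNIV_sum_type:
  fixes f :: "'n::finite + 'm::finite \<Rightarrow> 'b::comm_monoid_add"
  shows "(\<Sum>i\<in>UNIV. f i) = (\<Sum>a\<in>UNIV. f (Inl a)) + (\<Sum>b\<in>UNIV. f (Inr b))"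
  by (simp add: UNIV_Plus_UNIV[symmetric] sum.Plus comp_def del: UNIV_Plus_UNIV)

lemma block_quadratic_form:
  "block_vector u v \<bullet> (block_matrix M11 M12 M21 M22 *v block_vector u v)
     = u \<bullet> (M11 *v u) + u \<bullet> (M12 *v v) + v \<bullet> (M21 *v u) + v \<bullet> (M22 *v v)"
  by (simp add: inner_vec_def matrix_vector_mult_def block_matrix_def block_vector_def
      sum_UNIV_sum_type sum.distrib algebra_simps)

lemma sym_block_matrix_iff:
  "sym_matrix (block_matrix M11 M12 M21 M22)
     \<longleftrightarrow> sym_matrix M11 \<and> transpose M12 = M21 \<and> sym_matrix M22"
  unfolding sym_matrix_def block_matrix_def transpose_def vec_eq_iff
  by (auto simp: split_sum_all)

text \<open>With a zero lower right block the quadratic form is affine in the second component, so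
  it stays bounded below only if the cross term vanishes.\<close>

lemma pos_semidef_block_zero_iff:
  fixes M :: "real ^ 'n ^ 'n" and N :: "real ^ 'm ^ 'n"
  shows "pos_semidef (block_matrix M N N' 0) \<longleftrightarrow> pos_semidef M \<and> N = 0 \<and> N' = 0"
proof
  assume *: "pos_semidef (block_matrix M N N' 0)"
  then have sym: "sym_matrix M" "transpose N = N'"
    by (simp_all add: pos_semidef_def sym_block_matrix_iff)
  have form: "0 \<le> u \<bullet> (M *v u) + 2 * (v \<bullet> (N' *v u))" for u v
  proof -
    have "u \<bullet> (N *v v) = v \<bullet> (N' *v u)"
      by (metis dot_lmul_matrix inner_commute sym(2) transpose_matrix_vector)
    then show ?thesis
      using * block_quadratic_form[of u v M N N' 0]
      by (simp add: pos_semidef_def) (metis add.commute)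
  qed
  have "N' *v u = 0" for u
  proof -
    have "(N' *v u) \<bullet> (N' *v u) = 0"
    proof (rule linear_coeff_zero_if_quadratic_nonneg)
      fix t
      show "0 \<le> 2 * t * ((N' *v u) \<bullet> (N' *v u)) + t\<^sup>2 * (u \<bullet> (M *v u))"
        \<comment> \<open>The test vector with components \<open>t *\<^sub>R u\<close> and
          \<open>N' *v u\<close> gives the squared norm of \<open>N' *v u\<close> as linear
          coefficient in \<open>t\<close>.\<close>
        using form[of "t *\<^sub>R u" "N' *v u"]
        by (simp add: matrix_vector_mult_scaleR power2_eq_square mult_ac)
    qed
    then show ?thesis by simp
  qed
  then have "N' = 0" by (metis matrix_eq matrix_vector_mult_0)
  moreover from this have "N = 0"
    using sym(2) by (auto simp: transpose_def vec_eq_iff)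
  moreover have "pos_semidef M"
    using form[of _ 0] sym(1) by (simp add: pos_semidef_def)
  ultimately show "pos_semidef M \<and> N = 0 \<and> N' = 0" by simp
next
  assume *: "pos_semidef M \<and> N = 0 \<and> N' = 0"
  have "0 \<le> x \<bullet> (block_matrix M N N' 0 *v x)" for x
    by (cases x rule: block_vector_cases) (use * in \<open>simp add: block_quadratic_form pos_semidef_def\<close>)
  moreover have "sym_matrix (block_matrix M N N' 0)"
    using * unfolding sym_block_matrix_iff
    by (simp add: pos_semidef_def sym_matrix_def transpose_def vec_eq_iff)
  ultimately show "pos_semidef (block_matrix M N N' 0)"
    by (simp add: pos_semidef_def)
qed

text \<open>Splits the block inequality into a Lyapunov inequality and the output condition, the
  form in which both directions of the port-Hamiltonian correspondence are proved.\<close>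

lemma kyp_solution_iff:
  "kyp_solution A B C X \<longleftrightarrow>
     sym_matrix X \<and> pos_semidef (- (transpose A ** X) - X ** A) \<and> C = transpose B ** X"
proof -
  have "transpose C - X ** B = 0" if "sym_matrix X" "C = transpose B ** X"
    using that by (simp add: matrix_transpose_mul sym_matrix_def)
  then show ?thesis
    by (auto simp: kyp_solution_def pos_semidef_block_zero_iff)
qed

section \<open>Linearity of products and transposes\<close>

lemma matrix_mult_linear_left:
  fixes A B :: "real ^ 'n ^ 'm" and C :: "real ^ 'p ^ 'n"
  shows "(A + B) ** C = A ** C + B ** C" "(A - B) ** C = A ** C - B ** C" "(- A) ** C = - (A ** C)"
    "(c *\<^sub>R A) ** C = c *\<^sub>R (A ** C)"
  by (simp_all add: vec_eq_iff matrix_matrix_mult_def sum.distrib algebra_simps sum_subtractf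
      sum_negf sum_distrib_left)

lemma matrix_mult_linear_right:
  fixes A B :: "real ^ 'n ^ 'm" and C :: "real ^ 'm ^ 'p"
  shows "C ** (A + B) = C ** A + C ** B" "C ** (A - B) = C ** A - C ** B" "C ** (- A) = - (C ** A)"
    "C ** (c *\<^sub>R A) = c *\<^sub>R (C ** A)"
  by (simp_all add: vec_eq_iff matrix_matrix_mult_def sum.distrib algebra_simps sum_subtractf
      sum_negf sum_distrib_left)

lemma transpose_linear:
  fixes A B :: "real ^ 'n ^ 'm"
  shows "transpose (A + B) = transpose A + transpose B" "transpose (A - B) = transpose A - transpose B"
    "transpose (- A) = - transpose A" "transpose (c *\<^sub>R A) = c *\<^sub>R transpose A"
  by (simp_all add: vec_eq_iff transpose_def)

text \<open>The skew part \<open>J\<close> cancels in the Lyapunov expression, leaving twice the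
  congruence of \<open>R\<close> by \<open>Q\<close>.\<close>

lemma ph_representation_imp_kyp_solution:
  assumes "ph_representation A B C J R Q"
  shows "kyp_solution A B C Q"
proof -
  from assms have J: "transpose J = - J" and R: "pos_semidef R" and Q: "pos_def Q"
    and A: "A = (J - R) ** Q" and C: "C = transpose B ** Q"
    by (auto simp: ph_representation_def)
  have "transpose R = R" "transpose Q = Q"
    using R Q by (simp_all add: pos_semidef_def pos_def_def sym_matrix_def)
  then have "- (transpose A ** Q) - Q ** A = 2 *\<^sub>R (Q ** R ** transpose Q)"
    by (simp add: A J matrix_transpose_mul transpose_linear matrix_mult_linear_right
        matrix_mult_linear_left matrix_mul_assoc scaleR_2)
  also have "pos_semidef \<dots>"
    using R sym_matrix_congruence[of R Q]
    by (simp add: pos_semidef_def scaleR_matrix_vector_assoc[symmetric] inner_congruence)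
      (simp add: sym_matrix_def transpose_linear)
  finally show ?thesis
    using Q C by (simp add: kyp_solution_iff pos_def_def)
qed

text \<open>Congruence by \<open>matrix_inv X\<close> turns the Lyapunov expression into twice
  \<open>R_of A X\<close>, while \<open>J_of A X\<close> and \<open>- R_of A X\<close> are the skew
  and symmetric parts of \<open>A ** matrix_inv X\<close>.\<close>

lemma kyp_solution_imp_ph_representation:
  fixes A X :: "real ^ 'n ^ 'n"
  assumes X: "pos_def X" and "kyp_solution A B C X"
  shows "ph_representation A B C (J_of A X) (R_of A X) X"
proof -
  let ?Y = "matrix_inv X"
  have Y: "transpose ?Y = ?Y"
    using sym_matrix_inv[OF X] by (simp add: sym_matrix_def)
  have K: "pos_semidef (- (transpose A ** X) - X ** A)" and C: "C = transpose B ** X"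
    using assms(2) by (simp_all add: kyp_solution_iff)
  have "?Y ** (transpose A ** X) ** ?Y = ?Y ** transpose A" "?Y ** (X ** A) ** ?Y = A ** ?Y"
    by (metis matrix_mul_assoc matrix_mul_rid pos_def_matrix_inv(1)[OF X])
      (metis matrix_mul_assoc matrix_mul_lid pos_def_matrix_inv(2)[OF X])
  then have R: "R_of A X = (1 / 2) *\<^sub>R (?Y ** (- (transpose A ** X) - X ** A) ** transpose ?Y)"
    by (simp add: R_of_def Y matrix_mult_linear_left matrix_mult_linear_right algebra_simps)
  have "pos_semidef (R_of A X)"
    using K sym_matrix_congruence[of "- (transpose A ** X) - X ** A" ?Y] unfolding R
    by (simp add: pos_semidef_def scaleR_matrix_vector_assoc[symmetric] inner_congruence)
      (simp add: sym_matrix_def transpose_linear)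
  moreover have "transpose (J_of A X) = - J_of A X"
    by (simp add: J_of_def transpose_linear matrix_transpose_mul Y algebra_simps)
  moreover have "J_of A X - R_of A X = A ** ?Y"
    by (simp add: J_of_def R_of_def algebra_simps scaleR_add_left[symmetric])
  then have "(J_of A X - R_of A X) ** X = A"
    by (simp add: matrix_mul_assoc[symmetric] pos_def_matrix_inv[OF X])
  ultimately show ?thesis
    using X C by (simp add: ph_representation_def)
qed

theorem mainTheorem4:
  fixes J R Q A Pc L Xmax :: "real ^ ('n :: {finite, linorder}) ^ ('n :: {finite, linorder})"
    and B :: "real ^ 'm ^ ('n :: {finite, linorder})"
    and C :: "real ^ ('n :: {finite, linorder}) ^ 'm"
  assumes "ph_representation A B C J R Q"
    and "controllable A B"
    and "observable A C"
    and "stabilizing_riccati_solution A B C Pc"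
    and "cholesky_decomposition Pc L"
    and "pos_def Xmax"
    and "maximal_kyp_solution A B C Xmax"
  shows "(\<forall>X. pos_def X \<and> kyp_solution A B C X \<longrightarrow>
            (\<forall>i \<in> {1..CARD('n)}. theta Pc L i Xmax \<le> theta Pc L i X))
       \<and> (kyp_solution A B C Q \<and>
            (\<forall>i \<in> {1..CARD('n)}. theta Pc L i Xmax \<le> theta Pc L i Q))
       \<and> (\<forall>r. is_arg_min (\<lambda>(J', R', X). error_bound Pc L r X)
                 (\<lambda>(J', R', X). ph_representation A B C J' R' X \<and> kyp_solution A B C X)
                 (J_of A Xmax, R_of A Xmax, Xmax))"
proof -
  have Pc: "pos_semidef Pc"
    using assms(5) by (simp add: cholesky_decomposition_def pos_semidef_gram)
  have Xmax: "kyp_solution A B C Xmax"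
    using assms(7) by (simp add: maximal_kyp_solution_def)
  \<comment> \<open>Maximality ranges over semidefinite solutions; a positive definite
    \<open>X\<close> is one, hence lies below \<open>Xmax\<close>.\<close>
  have theta: "theta Pc L i Xmax \<le> theta Pc L i X"
    if "pos_def X" "kyp_solution A B C X" "i \<in> {1..CARD('n)}" for X i
    using that Pc assms(6,7) pos_def_imp_pos_semidef
    by (intro theta_antimono) (auto simp: maximal_kyp_solution_def)
  \<comment> \<open>All indices from \<open>r + 1\<close> to \<open>CARD('n)\<close> lie in the
    range of \<open>theta\<close>, so the sums compare termwise; for large \<open>r\<close> both are
    empty.\<close>
  have "error_bound Pc L r Xmax \<le> error_bound Pc L r X"
    if "pos_def X" "kyp_solution A B C X" for X r
    unfolding error_bound_def using that by (auto intro!: sum_mono theta)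
  moreover have "ph_representation A B C (J_of A Xmax) (R_of A Xmax) Xmax"
    using assms(6) Xmax by (rule kyp_solution_imp_ph_representation)
  \<comment> \<open>The cost depends only on the third component, so feasibility of the triple at
    \<open>Xmax\<close> together with the bound comparison gives minimality.\<close>
  ultimately have "is_arg_min (\<lambda>(J', R', X). error_bound Pc L r X)
      (\<lambda>(J', R', X). ph_representation A B C J' R' X \<and> kyp_solution A B C X)
      (J_of A Xmax, R_of A Xmax, Xmax)" for r
    using Xmax by (force simp: is_arg_min_def ph_representation_def not_less)
  moreover have "kyp_solution A B C Q" "pos_def Q"
    using ph_representation_imp_kyp_solution[OF assms(1)] assms(1)
    by (simp_all add: ph_representation_def)
  ultimately show ?thesis
    using theta by blast
qed

end
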